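(* Let $f^0(x,y)$ be a curvature surface on $D=\{(x,y)\in\mathbb{R}^2:x>0\}$ equipped with its frame field $F^0=[\phi,X^0_\alpha,X^0_\beta,\xi]$ (see context). Then: (1) The unit analytic vector $\boldsymbol{u}(y):=(1+y^2)^{-1/2}\,[yX^0_\beta-\phi](x,y)$ depends only on $y$. (2) Any $x$-curve $x\mapsto f^0(x,y)$ with fixed $y$ lies on a standard $2$-sphere $\mathbb{S}^2_y$ of radius $(2\sqrt5)^{-1}\sqrt{(5+4y^2)/(1+y^2)}$ in an affine hyperplane perpendicular to $\boldsymbol{u}(y)$. (3) The unit analytic vector $\tilde{\boldsymbol{u}}(x):=(B_2^2+C_2^2)^{-1/2}(x)\,(-B_2X^0_\alpha+C_2\xi)(x,y)$ depends only on $x$, where $B_2(x)=-\frac12\frac{X_0'(x)}{x}-\sqrt5$ and $C_2(x)=X_0''(x)-\frac{X_0'(x)}{x}$. (4) Any $y$-curve $y\mapsto f^0(x,y)$ with fixed $x$ lies on a standard $2$-sphere $\mathbb{S}^2_x$ of radius $(B_2^2+C_2^2)^{-1/2}(x)$ in an affine hyperplane perpendicular to $\tilde{\boldsymbol{u}}(x)$.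
   Context: $X_0(x)=\frac52+\sum_{k\ge1}a_kx^{2k}$ (analytic on $\mathbb{R}$), $a_1=1$, $2(k+1)(4k^2+\frac54)a_{k+1}+(2k-1)a_k=0$ $(k\ge1)$. $h(x,y)=2X_0-xX_0'+y^2\frac{X_0'}{x}+\sqrt5$ (positive). On $D$ put $a_1=\frac{2y}{xh}(X_0+\frac{\sqrt5}{2})$, $b_1=-\frac{1}{xh}(X_0+\frac{\sqrt5}{2}+\sqrt5(x^2-y^2))$, $c_1=-\frac{2}{xh}(X_0+\frac{\sqrt5}{2})$, $a_2=-\frac1h(2X_0+\sqrt5-(x^2+y^2)\frac{X_0'}{x})$, $b_2=-\frac{2y}{h}(\frac{X_0'}{2x}+\sqrt5)$, $c_2=\frac{2y}{h}(X_0''-\frac{X_0'}{x})$. The frame field is an analytic orthonormal frame field $F^0=[\phi,X^0_\alpha,X^0_\beta,\xi]$ of $\mathbb{R}^4$ on $D$ satisfying $\phi_x=-a_1X^0_\alpha$, $\xi_x=b_1X^0_\alpha$, $(X^0_\beta)_x=c_1X^0_\alpha$, $(X^0_\alpha)_x=a_1\phi-b_1\xi-c_1X^0_\beta$, $\phi_y=-a_2X^0_\beta$, $\xi_y=b_2X^0_\beta$, $(X^0_\alpha)_y=c_2X^0_\beta$, $(X^0_\beta)_y=a_2\phi-b_2\xi-c_2X^0_\alpha$ (such a field exists and is unique up to left multiplication by a constant orthogonal matrix). The curvature surface $f^0:D\to\mathbb{R}^4$ determined by $F^0$ is the analytic map, unique up to translation, with $df^0=\frac{x^2-y^2}{xh}X^0_\alpha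 dx+\frac{2y}{h}X^0_\beta dy$. *)

theory Defs
  imports "HOL-Analysis.Analysis"
begin

text \<open>Real analyticity in several variables: around every point of \<open>S\<close> the map is the sum of a
  power series with multi-indices \<open>\<alpha>\<close> over the coordinates \<open>Basis\<close>.\<close>

definition real_analytic_on ::
    "('a::euclidean_space \<Rightarrow> 'b::euclidean_space) \<Rightarrow> 'a set \<Rightarrow> bool"
    (infix "real'_analytic'_on" 50) where
  "f real_analytic_on S \<longleftrightarrow>
     (\<forall>p\<in>S. \<exists>r>0. \<exists>c :: ('a \<Rightarrow> nat) \<Rightarrow> 'b. \<forall>z\<in>ball p r.
        ((\<lambda>\<alpha>. (\<Prod>b\<in>Basis. ((z - p) \<bullet> b) ^ \<alpha> b) *\<^sub>R c \<alpha>) has_sum f z) (Basis \<rightarrow>\<^sub>E UNIV))"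

text \<open>A round 2-sphere of radius \<open>r\<close> in an affine hyperplane of \<open>\<real>\<^sup>4\<close> with normal \<open>n\<close>;
  the centre lies in that hyperplane.\<close>

definition is_sphere2_in_hyperplane :: "(real^4) set \<Rightarrow> real \<Rightarrow> real^4 \<Rightarrow> bool" where
  "is_sphere2_in_hyperplane S r n \<longleftrightarrow>
     r > 0 \<and> n \<noteq> 0 \<and> (\<exists>c. S = sphere c r \<inter> {p. n \<bullet> p = n \<bullet> c})"

text \<open>The coefficient of \<open>x ^ (2 * k)\<close> in \<open>X0\<close>; index \<open>0\<close> is the constant term.\<close>

fun X0_coeff :: "nat \<Rightarrow> real" where
  "X0_coeff 0 = 5 / 2"
| "X0_coeff (Suc 0) = 1"
| "X0_coeff (Suc (Suc j)) = (let k = real (Suc j) in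
     - ((2 * k - 1) * X0_coeff (Suc j)) / (2 * (k + 1) * (4 * k\<^sup>2 + 5 / 4)))"

lemma X0_coeff_recurrence:
  assumes "k \<ge> 1"
  shows "2 * (real k + 1) * (4 * (real k)\<^sup>2 + 5 / 4) * X0_coeff (k + 1)
           + (2 * real k - 1) * X0_coeff k = 0"
proof -
  obtain j where j: "k = Suc j"
    using assms by (cases k) auto
  have "2 * (real k + 1) * (4 * (real k)\<^sup>2 + 5 / 4) \<noteq> 0" (is "?d \<noteq> 0")
    by (smt (verit) mult_eq_0_iff of_nat_0_le_iff zero_le_power2 divide_pos_pos)
  moreover have "X0_coeff (k + 1) =
      - ((2 * real k - 1) * X0_coeff k) / (2 * (real k + 1) * (4 * (real k)\<^sup>2 + 5 / 4))" (is "_ = ?n / _")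
    unfolding j by (simp add: Let_def)
  ultimately have "?d * X0_coeff (k + 1) = ?n"
    by (metis nonzero_mult_div_cancel_left times_divide_eq_right)
  then show ?thesis
    by linarith
qed

definition X0 :: "real \<Rightarrow> real" where
  "X0 x = (\<Sum>k. X0_coeff k * x ^ (2 * k))"

abbreviation X0' :: "real \<Rightarrow> real" where
  "X0' \<equiv> deriv X0"

abbreviation X0'' :: "real \<Rightarrow> real" where
  "X0'' \<equiv> deriv (deriv X0)"

definition D :: "(real \<times> real) set" where
  "D = {(x, y). x > 0}"

definition hh :: "real \<Rightarrow> real \<Rightarrow> real" where
  "hh x y = 2 * X0 x - x * X0' x + y\<^sup>2 * (X0' x / x) + sqrt 5"

definition a1 :: "real \<Rightarrow> real \<Rightarrow> real" where
  "a1 x y = 2 * y / (x * hh x y) * (X0 x + sqrt 5 / 2)"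

definition b1 :: "real \<Rightarrow> real \<Rightarrow> real" where
  "b1 x y = - (1 / (x * hh x y)) * (X0 x + sqrt 5 / 2 + sqrt 5 * (x\<^sup>2 - y\<^sup>2))"

definition c1 :: "real \<Rightarrow> real \<Rightarrow> real" where
  "c1 x y = - (2 / (x * hh x y)) * (X0 x + sqrt 5 / 2)"

definition a2 :: "real \<Rightarrow> real \<Rightarrow> real" where
  "a2 x y = - (1 / hh x y) * (2 * X0 x + sqrt 5 - (x\<^sup>2 + y\<^sup>2) * (X0' x / x))"

definition b2 :: "real \<Rightarrow> real \<Rightarrow> real" where
  "b2 x y = - (2 * y / hh x y) * (X0' x / (2 * x) + sqrt 5)"

definition c2 :: "real \<Rightarrow> real \<Rightarrow> real" where
  "c2 x y = 2 * y / hh x y * (X0'' x - X0' x / x)"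

definition B2 :: "real \<Rightarrow> real" where
  "B2 x = - (1 / 2) * (X0' x / x) - sqrt 5"

definition C2 :: "real \<Rightarrow> real" where
  "C2 x = X0'' x - X0' x / x"

definition orthonormal4 :: "real^4 \<Rightarrow> real^4 \<Rightarrow> real^4 \<Rightarrow> real^4 \<Rightarrow> bool" where
  "orthonormal4 p q r s \<longleftrightarrow>
     norm p = 1 \<and> norm q = 1 \<and> norm r = 1 \<and> norm s = 1 \<and>
     p \<bullet> q = 0 \<and> p \<bullet> r = 0 \<and> p \<bullet> s = 0 \<and> q \<bullet> r = 0 \<and> q \<bullet> s = 0 \<and> r \<bullet> s = 0"

definition frame_field ::
    "(real \<times> real \<Rightarrow> real^4) \<Rightarrow> (real \<times> real \<Rightarrow> real^4) \<Rightarrow>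
     (real \<times> real \<Rightarrow> real^4) \<Rightarrow> (real \<times> real \<Rightarrow> real^4) \<Rightarrow> bool" where
  "frame_field \<phi> X\<alpha> X\<beta> \<xi> \<longleftrightarrow>
     \<phi> real_analytic_on D \<and> X\<alpha> real_analytic_on D \<and>
     X\<beta> real_analytic_on D \<and> \<xi> real_analytic_on D \<and>
     (\<forall>x y. (x, y) \<in> D \<longrightarrow>
        orthonormal4 (\<phi> (x, y)) (X\<alpha> (x, y)) (X\<beta> (x, y)) (\<xi> (x, y)) \<and>
        ((\<lambda>t. \<phi> (t, y)) has_vector_derivative - a1 x y *\<^sub>R X\<alpha> (x, y)) (at x) \<and>
        ((\<lambda>t. \<xi> (t, y)) has_vector_derivative b1 x y *\<^sub>R X\<alpha> (x, y)) (at x) \<and>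
        ((\<lambda>t. X\<beta> (t, y)) has_vector_derivative c1 x y *\<^sub>R X\<alpha> (x, y)) (at x) \<and>
        ((\<lambda>t. X\<alpha> (t, y)) has_vector_derivative
           a1 x y *\<^sub>R \<phi> (x, y) - b1 x y *\<^sub>R \<xi> (x, y) - c1 x y *\<^sub>R X\<beta> (x, y)) (at x) \<and>
        ((\<lambda>t. \<phi> (x, t)) has_vector_derivative - a2 x y *\<^sub>R X\<beta> (x, y)) (at y) \<and>
        ((\<lambda>t. \<xi> (x, t)) has_vector_derivative b2 x y *\<^sub>R X\<beta> (x, y)) (at y) \<and>
        ((\<lambda>t. X\<alpha> (x, t)) has_vector_derivative c2 x y *\<^sub>R X\<beta> (x, y)) (at y) \<and>
        ((\<lambda>t. X\<beta> (x, t)) has_vector_derivative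
           a2 x y *\<^sub>R \<phi> (x, y) - b2 x y *\<^sub>R \<xi> (x, y) - c2 x y *\<^sub>R X\<alpha> (x, y)) (at y))"

definition curvature_surface ::
    "(real \<times> real \<Rightarrow> real^4) \<Rightarrow> (real \<times> real \<Rightarrow> real^4) \<Rightarrow> (real \<times> real \<Rightarrow> real^4) \<Rightarrow>
     (real \<times> real \<Rightarrow> real^4) \<Rightarrow> (real \<times> real \<Rightarrow> real^4) \<Rightarrow> bool" where
  "curvature_surface f \<phi> X\<alpha> X\<beta> \<xi> \<longleftrightarrow>
     frame_field \<phi> X\<alpha> X\<beta> \<xi> \<and> f real_analytic_on D \<and>
     (\<forall>x y. (x, y) \<in> D \<longrightarrow>
        (f has_derivative
           (\<lambda>(dx, dy). dx *\<^sub>R ((x\<^sup>2 - y\<^sup>2) / (x * hh x y)) *\<^sub>R X\<alpha> (x, y)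
                     + dy *\<^sub>R (2 * y / hh x y) *\<^sub>R X\<beta> (x, y))) (at (x, y)))"

end

theory Submission
  imports Defs "HOL-Complex_Analysis.Complex_Analysis"
begin

text \<open>Along an $x$-curve the four moving vectors $f$, $\phi$, $X_\beta$, $\xi$ all have derivatives
  parallel to $X_\alpha$, so suitable combinations with coefficients depending on $y$ alone are
  constant in $x$: one gives $u(y)$, another the centre of the sphere. The $y$-curves are treated
  in the same way with $f$, $X_\alpha$, $\xi$. The remaining point is that $B_2^2 + C_2^2$ never
  vanishes. With $w = X_0'/x$ and $\theta = x\,d/dx$ the recurrence of the coefficients gives
  $\theta^2 w + (5/4 + x^2) w = X_0$, whence $2 w X_0 - (5/4 + x^2) w^2 - (\theta w)^2 = 5$ for
  all $x$. So $w$ has no zero, hence $w > 0$ and $B_2 < 0$.\<close>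

subsection \<open>Real analyticity along coordinate lines and complex extensions\<close>

text \<open>On the line through \<open>p\<close> in direction \<open>e\<close>, every monomial with
  a positive exponent at another basis vector vanishes. What remains of the multi-index series is an
  ordinary power series in \<open>t\<close>.\<close>

lemma real_analytic_on_line:
  fixes f :: "'a::euclidean_space \<Rightarrow> 'b::euclidean_space"
  assumes f: "f real_analytic_on S" and p: "p \<in> S" and e: "e \<in> Basis"
  shows "\<exists>r>0. \<exists>c. \<forall>t. \<bar>t\<bar> < r \<longrightarrow> ((\<lambda>n. t ^ n *\<^sub>R c n) has_sum f (p + t *\<^sub>R e)) UNIV"
proof -
  obtain r c where r: "r > 0" and c: "\<And>z. z \<in> ball p r \<Longrightarrow>
      ((\<lambda>\<alpha>. (\<Prod>b\<in>Basis. ((z - p) \<bullet> b) ^ \<alpha> b) *\<^sub>R c \<alpha>) has_sum f z) (Basis \<rightarrow>\<^sub>E UNIV)"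
    using f p unfolding real_analytic_on_def by meson
  \<comment> \<open>\<open>\<iota> n\<close> is the multi-index with \<open>n\<close> at
    \<open>e\<close> and 0 elsewhere. It is restricted to \<open>Basis\<close> so that it lies in
    the extensional function space over which the series is summed.\<close>
  define \<iota> where "\<iota> n = (\<lambda>b\<in>Basis::'a set. if b = e then n else 0 :: nat)" for n
  define A where "A = range \<iota>"
  have inj: "inj \<iota>"
  proof (rule injI)
    fix m n assume "\<iota> m = \<iota> n"
    then have "\<iota> m e = \<iota> n e" by simp
    then show "m = n" using e by (simp add: \<iota>_def)
  qed
  then have bij: "bij_betw \<iota> UNIV A"
    by (simp add: A_def bij_betw_def)
  have A_sub: "A \<subseteq> Basis \<rightarrow>\<^sub>E UNIV"
    by (auto simp: A_def \<iota>_def)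
  have A_iff: "\<alpha> \<in> A" if "\<alpha> \<in> Basis \<rightarrow>\<^sub>E UNIV" "\<And>b. b \<in> Basis \<Longrightarrow> b \<noteq> e \<Longrightarrow> \<alpha> b = 0" for \<alpha>
  proof -
    have "\<alpha> = \<iota> (\<alpha> e)"
      using that e by (auto simp: \<iota>_def fun_eq_iff PiE_def extensional_def restrict_def)
    then show ?thesis by (auto simp: A_def)
  qed
  have prod_zero: "(\<Prod>b\<in>Basis. ((p + t *\<^sub>R e - p) \<bullet> b) ^ \<alpha> b) = 0"
    if \<alpha>: "\<alpha> \<in> (Basis \<rightarrow>\<^sub>E UNIV) - A" for t \<alpha>
  proof -
    obtain b where b: "b \<in> Basis" "b \<noteq> e" "\<alpha> b \<noteq> 0"
      using A_iff \<alpha> by auto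
    then have "((p + t *\<^sub>R e - p) \<bullet> b) ^ \<alpha> b = 0"
      using e by (simp add: inner_Basis)
    then show ?thesis using b by (meson finite_Basis prod_zero)
  qed
  have prod_pow: "(\<Prod>b\<in>Basis. ((p + t *\<^sub>R e - p) \<bullet> b) ^ \<iota> n b) = t ^ n" for t n
  proof -
    have "(\<Prod>b\<in>Basis. ((p + t *\<^sub>R e - p) \<bullet> b) ^ \<iota> n b) = (\<Prod>b\<in>Basis. if b = e then t ^ n else 1)"
      by (rule prod.cong) (use e in \<open>auto simp: \<iota>_def inner_Basis\<close>)
    then show ?thesis using e by simp
  qed
  have sum: "((\<lambda>n. t ^ n *\<^sub>R c (\<iota> n)) has_sum f (p + t *\<^sub>R e)) UNIV" if t: "\<bar>t\<bar> < r" for t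
  proof -
    have "p + t *\<^sub>R e \<in> ball p r"
      using t e by (simp add: dist_norm)
    from c[OF this] have "((\<lambda>\<alpha>. (\<Prod>b\<in>Basis. ((p + t *\<^sub>R e - p) \<bullet> b) ^ \<alpha> b) *\<^sub>R c \<alpha>) has_sum f (p + t *\<^sub>R e)) A"
      by (subst has_sum_cong_neutral[where T = "Basis \<rightarrow>\<^sub>E UNIV"])
         (use A_sub prod_zero in \<open>auto\<close>)
    then have "((\<lambda>n. (\<Prod>b\<in>Basis. ((p + t *\<^sub>R e - p) \<bullet> b) ^ \<iota> n b) *\<^sub>R c (\<iota> n)) has_sum
        f (p + t *\<^sub>R e)) UNIV"
      using has_sum_reindex_bij_betw[OF bij, of "\<lambda>\<alpha>. (\<Prod>b\<in>Basis. ((p + t *\<^sub>R e - p) \<bullet> b) ^ \<alpha> b) *\<^sub>R c \<alpha>"]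
      by blast
    then show ?thesis unfolding prod_pow .
  qed
  show ?thesis
    using r by (intro exI[of _ r] conjI exI[of _ "\<lambda>n. c (\<iota> n)"] allI impI sum)
qed

text \<open>The space \<open>real\<close> has the single basis vector 1, so evaluation at 1
  identifies multi-indices with plain exponents.\<close>

lemma real_analytic_onI_power_series:
  fixes f :: "real \<Rightarrow> 'b::euclidean_space"
  assumes "\<And>p. p \<in> S \<Longrightarrow> \<exists>r>0. \<exists>c. \<forall>z\<in>ball p r. ((\<lambda>n. (z - p) ^ n *\<^sub>R c n) has_sum f z) UNIV"
  shows "f real_analytic_on S"
  unfolding real_analytic_on_def
proof
  fix p assume "p \<in> S"
  then obtain r c where r: "r > 0"
    and c: "\<And>z. z \<in> ball p r \<Longrightarrow> ((\<lambda>n. (z - p) ^ n *\<^sub>R c n) has_sum f z) UNIV"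
    using assms by meson
  have bij: "bij_betw (\<lambda>\<alpha>. \<alpha> 1) ((Basis :: real set) \<rightarrow>\<^sub>E (UNIV :: nat set)) UNIV"
  proof (rule bij_betw_byWitness[where f' = "\<lambda>n. \<lambda>b\<in>Basis. n"])
    show "\<forall>\<alpha>\<in>(Basis :: real set) \<rightarrow>\<^sub>E (UNIV :: nat set). (\<lambda>b\<in>Basis. \<alpha> 1) = \<alpha>"
    proof
      fix \<alpha> :: "real \<Rightarrow> nat" assume "\<alpha> \<in> Basis \<rightarrow>\<^sub>E UNIV"
      then show "(\<lambda>b\<in>Basis. \<alpha> 1) = \<alpha>"
        by (intro PiE_ext[of _ "Basis :: real set" "\<lambda>_. UNIV"]) auto
    qed
    show "(\<lambda>n. \<lambda>b\<in>Basis. n) ` UNIV \<subseteq> (Basis :: real set) \<rightarrow>\<^sub>E (UNIV :: nat set)"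
      by (intro image_subsetI restrict_PiE_iff[THEN iffD2]) simp
  qed auto
  have sum: "((\<lambda>\<alpha>. (\<Prod>b\<in>Basis. ((z - p) \<bullet> b) ^ \<alpha> b) *\<^sub>R c (\<alpha> 1)) has_sum f z) (Basis \<rightarrow>\<^sub>E UNIV)"
    if "z \<in> ball p r" for z
    using c[OF that] by (simp flip: has_sum_reindex_bij_betw[OF bij])
  show "\<exists>r>0. \<exists>c. \<forall>z\<in>ball p r.
      ((\<lambda>\<alpha>. (\<Prod>b\<in>Basis. ((z - p) \<bullet> b) ^ \<alpha> b) *\<^sub>R c \<alpha>) has_sum f z) (Basis \<rightarrow>\<^sub>E UNIV)"
    using r by (intro exI[of _ r] conjI exI[of _ "\<lambda>\<alpha>. c (\<alpha> 1)"] ballI sum)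
qed

text \<open>A complex extension near \<open>p\<close> reduces closure under products, inverse square
  roots and composition to facts about holomorphic functions. A real power series is recovered at
  the end from the Taylor series of \<open>G\<close>.\<close>

definition locally_holomorphic :: "(real \<Rightarrow> real) \<Rightarrow> real \<Rightarrow> bool" where
  "locally_holomorphic g p \<longleftrightarrow> (\<exists>G. G analytic_on {complex_of_real p} \<and>
     (\<forall>\<^sub>F x in nhds p. G (of_real x) = of_real (g x)))"

section \<open>Closure properties of functions with a local holomorphic extension\<close>

lemma locally_holomorphic_cong:
  assumes "locally_holomorphic g p" "\<forall>\<^sub>F x in nhds p. g x = h x"
  shows "locally_holomorphic h p"
proof -
  obtain G where G: "G analytic_on {of_real p}" "\<forall>\<^sub>F x in nhds p. G (of_real x) = of_real (g x)"
    using assms(1) unfolding locally_holomorphic_def by blast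
  have "\<forall>\<^sub>F x in nhds p. G (of_real x) = of_real (h x)"
    using G(2) assms(2) by eventually_elim simp
  then show ?thesis using G(1) unfolding locally_holomorphic_def by blast
qed

lemma locally_holomorphic_const: "locally_holomorphic (\<lambda>_. k) p"
  unfolding locally_holomorphic_def by (rule exI[of _ "\<lambda>_. of_real k"]) auto

lemma locally_holomorphic_ident: "locally_holomorphic (\<lambda>x. x) p"
  unfolding locally_holomorphic_def by (rule exI[of _ "\<lambda>z. z"]) auto

text \<open>\<open>op'\<close> is the complex counterpart of the real operation \<open>op\<close>;
  one argument then serves sums, differences and products.\<close>

lemma locally_holomorphic_binop:
  assumes "locally_holomorphic g p" "locally_holomorphic h p"
    and "\<And>G H. G analytic_on {of_real p} \<Longrightarrow> H analytic_on {of_real p} \<Longrightarrow>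
           (\<lambda>z. op' (G z) (H z)) analytic_on {complex_of_real p}"
    and "\<And>a b. op' (of_real a) (of_real b) = of_real (op a b)"
  shows "locally_holomorphic (\<lambda>x. op (g x) (h x)) p"
proof -
  obtain G H where G: "G analytic_on {of_real p}" "\<forall>\<^sub>F x in nhds p. G (of_real x) = of_real (g x)"
    and H: "H analytic_on {of_real p}" "\<forall>\<^sub>F x in nhds p. H (of_real x) = of_real (h x)"
    using assms(1,2) unfolding locally_holomorphic_def by blast
  have "\<forall>\<^sub>F x in nhds p. op' (G (of_real x)) (H (of_real x)) = of_real (op (g x) (h x))"
    using G(2) H(2) by eventually_elim (simp add: assms(4))
  then show ?thesis
    unfolding locally_holomorphic_def using assms(3)[OF G(1) H(1)] by blast
qed

lemma locally_holomorphic_add: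
  "locally_holomorphic g p \<Longrightarrow> locally_holomorphic h p \<Longrightarrow> locally_holomorphic (\<lambda>x. g x + h x) p"
  by (rule locally_holomorphic_binop[where op' = "(+)" and op = "(+)"]) (auto intro: analytic_intros)

lemma locally_holomorphic_diff:
  "locally_holomorphic g p \<Longrightarrow> locally_holomorphic h p \<Longrightarrow> locally_holomorphic (\<lambda>x. g x - h x) p"
  by (rule locally_holomorphic_binop[where op' = "(-)" and op = "(-)"]) (auto intro: analytic_intros)

lemma locally_holomorphic_mult:
  "locally_holomorphic g p \<Longrightarrow> locally_holomorphic h p \<Longrightarrow> locally_holomorphic (\<lambda>x. g x * h x) p"
  by (rule locally_holomorphic_binop[where op' = "(*)" and op = "(*)"]) (auto intro: analytic_intros)

lemma locally_holomorphic_power: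
  "locally_holomorphic g p \<Longrightarrow> locally_holomorphic (\<lambda>x. g x ^ n) p"
  by (induction n) (simp_all add: locally_holomorphic_const locally_holomorphic_mult)

text \<open>Since \<open>g p > 0\<close>, the value of the extension at \<open>p\<close> avoids the
  branch cut of \<open>csqrt\<close>. Nonnegativity of \<open>g\<close> makes \<open>csqrt\<close>
  agree with the real square root along the real axis.\<close>

lemma locally_holomorphic_inverse_sqrt:
  assumes "locally_holomorphic g p" "\<And>x. g x \<ge> 0" "g p > 0"
  shows "locally_holomorphic (\<lambda>x. 1 / sqrt (g x)) p"
proof -
  obtain G where G: "G analytic_on {of_real p}" "\<forall>\<^sub>F x in nhds p. G (of_real x) = of_real (g x)"
    using assms(1) unfolding locally_holomorphic_def by blast
  have Gp: "G (of_real p) = of_real (g p)"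
    using G(2) by (rule eventually_nhds_x_imp_x)
  have "(\<lambda>z. csqrt (G z)) analytic_on {of_real p}"
    using G(1) by (rule analytic_on_csqrt') (use assms(3) Gp in \<open>auto simp: complex_nonpos_Reals_iff\<close>)
  then have "(\<lambda>z. 1 / csqrt (G z)) analytic_on {of_real p}"
    by (intro analytic_on_divide analytic_on_const) (use Gp assms(3) in auto)
  moreover have "\<forall>\<^sub>F x in nhds p. 1 / csqrt (G (of_real x)) = of_real (1 / sqrt (g x))"
    using G(2) by eventually_elim (simp add: csqrt_of_real assms(2))
  ultimately show ?thesis
    unfolding locally_holomorphic_def by blast
qed

lemma locally_holomorphic_compose:
  assumes "locally_holomorphic h (g p)" "locally_holomorphic g p" "isCont g p"
  shows "locally_holomorphic (\<lambda>x. h (g x)) p"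
proof -
  obtain G H where G: "G analytic_on {of_real p}" "\<forall>\<^sub>F x in nhds p. G (of_real x) = of_real (g x)"
    and H: "H analytic_on {of_real (g p)}" "\<forall>\<^sub>F y in nhds (g p). H (of_real y) = of_real (h y)"
    using assms(1,2) unfolding locally_holomorphic_def by blast
  have "G (of_real p) = of_real (g p)"
    using G(2) by (rule eventually_nhds_x_imp_x)
  then have "(H \<circ> G) analytic_on {of_real p}"
    using G(1) H(1) by (intro analytic_on_compose) auto
  \<comment> \<open>Continuity of \<open>g\<close> pulls the neighbourhood of \<open>g p\<close> on
    which \<open>H\<close> extends \<open>h\<close> back to a neighbourhood of
    \<open>p\<close>.\<close>
  moreover have "\<forall>\<^sub>F x in nhds p. H (of_real (g x)) = of_real (h (g x))"
    using eventually_compose_filterlim[OF H(2)] assms(3)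
    by (simp add: isCont_def tendsto_at_iff_tendsto_nhds)
  then have "\<forall>\<^sub>F x in nhds p. (H \<circ> G) (of_real x) = of_real (h (g x))"
    using G(2) by eventually_elim simp
  ultimately show ?thesis
    unfolding locally_holomorphic_def by blast
qed

text \<open>Convergence at all real \<open>t\<close> with absolute value below \<open>r\<close>
  forces convergence on the complex disc of radius \<open>r\<close>, so the same coefficients define
  a holomorphic extension. The centre \<open>q\<close> may differ from \<open>p\<close>, which lets
  a series at 0 serve every point of its interval.\<close>

lemma locally_holomorphic_power_series:
  assumes p: "\<bar>p - q\<bar> < r"
    and c: "\<And>t. \<bar>t\<bar> < r \<Longrightarrow> (\<lambda>n. c n * t ^ n) sums g (q + t)"
  shows "locally_holomorphic g p"
proof -
  define C where "C n = complex_of_real (c n)" for n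
  define G where "G z = (\<Sum>n. C n * (z - of_real q) ^ n)" for z
  have C: "(\<lambda>n. C n * of_real t ^ n) sums of_real (g (q + t))" if "\<bar>t\<bar> < r" for t
    using sums_of_real[OF c[OF that], where 'a = complex] by (simp add: C_def)
  have sm: "summable (\<lambda>n. C n * z ^ n)" if z: "norm z < r" for z
  proof -
    \<comment> \<open>Convergence is known at real points only; a real \<open>s\<close> outside the
      circle through \<open>z\<close> is enough.\<close>
    obtain s where s: "norm z < s" "s < r" using dense[OF z] by blast
    then have s0: "0 \<le> s" using norm_ge_zero[of z] by linarith
    have "summable (\<lambda>n. C n * of_real s ^ n)"
      using s s0 by (intro sums_summable[OF C[of s]]) simp
    then show ?thesis
      by (rule powser_inside) (use s s0 in simp)
  qed
  have "G holomorphic_on ball (of_real q) r"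
  proof -
    have "(G has_field_derivative (\<Sum>n. diffs C n * (z - of_real q) ^ n)) (at z)"
      if "z \<in> ball (of_real q) r" for z
    proof -
      have "norm (z - of_real q) < r"
        using that by (simp add: dist_norm norm_minus_commute)
      moreover have "((\<lambda>z. z - of_real q) has_field_derivative 1) (at z)"
        by (auto intro!: derivative_eq_intros)
      ultimately show ?thesis
        using DERIV_chain2[OF termdiffs_strong'[of r C, OF sm], of "\<lambda>z. z - of_real q" z 1 UNIV]
        by (simp add: G_def[abs_def])
    qed
    then show ?thesis
      unfolding holomorphic_on_open[OF open_ball] by blast
  qed
  moreover have "complex_of_real p \<in> ball (of_real q) r"
    using p by (simp add: dist_real_def abs_minus_commute)
  ultimately have "G analytic_on {of_real p}"
    unfolding analytic_at by blast
  moreover have "G (of_real x) = of_real (g x)" if "x \<in> ball q r" for x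
  proof -
    have "\<bar>x - q\<bar> < r" using that by (simp add: dist_real_def)
    from sums_unique[OF C[OF this]] show ?thesis by (simp add: G_def)
  qed
  then have "\<forall>\<^sub>F x in nhds p. G (of_real x) = of_real (g x)"
    by (intro eventually_mono[OF eventually_nhds_in_open[of "ball q r"]])
       (use p in \<open>auto simp: dist_real_def\<close>)
  ultimately show ?thesis
    unfolding locally_holomorphic_def by blast
qed

lemma real_analytic_on_imp_locally_holomorphic:
  fixes f :: "'a::euclidean_space \<Rightarrow> 'b::euclidean_space"
  assumes "f real_analytic_on S" "q + p *\<^sub>R e \<in> S" "e \<in> Basis"
  shows "locally_holomorphic (\<lambda>t. f (q + t *\<^sub>R e) \<bullet> b) p"
proof -
  obtain r c where r: "r > 0"
    and c: "\<And>t. \<bar>t\<bar> < r \<Longrightarrow> ((\<lambda>n. t ^ n *\<^sub>R c n) has_sum f (q + p *\<^sub>R e + t *\<^sub>R e)) UNIV"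
    using real_analytic_on_line[OF assms] by meson
  have "(\<lambda>n. (c n \<bullet> b) * t ^ n) sums (f (q + (p + t) *\<^sub>R e) \<bullet> b)" if "\<bar>t\<bar> < r" for t
    using has_sum_imp_sums[OF has_sum_bounded_linear[OF bounded_linear_inner_left[of b] c[OF that]]]
    by (simp add: algebra_simps)
  then show ?thesis
    using r by (intro locally_holomorphic_power_series[of p p r]) auto
qed

lemma has_sum_componentwise:
  fixes g :: "'a \<Rightarrow> 'b::euclidean_space"
  assumes "\<And>b. b \<in> Basis \<Longrightarrow> ((\<lambda>x. g x \<bullet> b) has_sum (l \<bullet> b)) A"
  shows "(g has_sum l) A"
  using assms unfolding has_sum_def
  by (subst tendsto_componentwise_iff) (simp add: inner_sum_left)

text \<open>The Taylor series of the extension at \<open>p\<close> is restricted to real arguments,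
  and the real parts of its coefficients are taken. Absolute convergence inside the disc turns the
  ordered sum into the unordered \<open>has_sum\<close>.\<close>

lemma locally_holomorphic_imp_power_series:
  assumes "locally_holomorphic g p"
  obtains c r where "r > 0"
    "\<And>z. z \<in> ball p r \<Longrightarrow> ((\<lambda>n. (z - p) ^ n * c n) has_sum g z) UNIV"
proof -
  obtain G e1 where G: "G holomorphic_on ball (complex_of_real p) e1" "e1 > 0"
    and "\<forall>\<^sub>F x in nhds p. G (of_real x) = of_real (g x)"
    using assms unfolding locally_holomorphic_def analytic_at_ball by blast
  then obtain e2 where e2: "e2 > 0" "\<And>x. dist x p < e2 \<Longrightarrow> G (of_real x) = of_real (g x)"
    unfolding eventually_nhds_metric by blast
  define C where "C n = (deriv ^^ n) G (of_real p) / fact n" for n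
  define r where "r = min e1 e2"
  have C: "(\<lambda>n. C n * (w - of_real p) ^ n) sums G w" if "w \<in> ball (of_real p) e1" for w
    using holomorphic_power_series[OF G(1) that] by (simp add: C_def)
  have "((\<lambda>n. (z - p) ^ n * Re (C n)) has_sum g z) UNIV" if z: "z \<in> ball p r" for z
  proof -
    have z': "\<bar>z - p\<bar> < r" using z by (simp add: dist_real_def)
    obtain s where s: "\<bar>z - p\<bar> < s" "s < r" using dense[OF z'] by blast
    have "summable (\<lambda>n. norm (C n * (of_real z - of_real p) ^ n))"
    proof (rule powser_insidea)
      show "summable (\<lambda>n. C n * of_real s ^ n)"
        using sums_summable[OF C[of "of_real p + of_real s"]] s by (auto simp: dist_norm r_def)
      show "norm (complex_of_real z - of_real p) < norm (complex_of_real s)"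
        using s by (simp flip: of_real_diff)
    qed
    moreover have "(\<lambda>n. C n * (of_real z - of_real p) ^ n) sums of_real (g z)"
    proof -
      have "complex_of_real z \<in> ball (of_real p) e1"
        using z' by (simp add: dist_real_def r_def abs_minus_commute)
      from C[OF this] show ?thesis
        using e2(2)[of z] z' by (simp add: dist_real_def r_def)
    qed
    ultimately have "((\<lambda>n. C n * (of_real z - of_real p) ^ n) has_sum of_real (g z)) UNIV"
      by (rule norm_summable_imp_has_sum)
    from has_sum_bounded_linear[OF bounded_linear_Re this] show ?thesis
      by (simp add: mult.commute flip: of_real_diff of_real_power)
  qed
  moreover have "r > 0" using G e2 by (simp add: r_def)
  ultimately show thesis by (intro that[of r "\<lambda>n. Re (C n)"])
qed

lemma real_analytic_onI_components:
  fixes f :: "real \<Rightarrow> 'b::euclidean_space"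
  assumes "\<And>p b. p \<in> S \<Longrightarrow> b \<in> Basis \<Longrightarrow> locally_holomorphic (\<lambda>t. f t \<bullet> b) p"
  shows "f real_analytic_on S"
proof (rule real_analytic_onI_power_series)
  fix p assume p: "p \<in> S"
  have "\<forall>b\<in>Basis. \<exists>c r. r > 0 \<and> (\<forall>z\<in>ball p r. ((\<lambda>n. (z - p) ^ n * c n) has_sum (f z \<bullet> b)) UNIV)"
    using locally_holomorphic_imp_power_series[OF assms[OF p]] by metis
  then obtain c r where r: "\<And>b. b \<in> Basis \<Longrightarrow> r b > 0"
    and c: "\<And>b z. b \<in> Basis \<Longrightarrow> z \<in> ball p (r b) \<Longrightarrow>
              ((\<lambda>n. (z - p) ^ n * c b n) has_sum (f z \<bullet> b)) UNIV"
    by metis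
  \<comment> \<open>There are finitely many components, so their discs of convergence contain a
    common one.\<close>
  define R where "R = Min (r ` (Basis :: 'b set))"
  have "R > 0" using r by (simp add: R_def)
  have sum: "((\<lambda>n. (z - p) ^ n *\<^sub>R (\<Sum>b\<in>Basis. c b n *\<^sub>R b)) has_sum f z) UNIV"
    if "z \<in> ball p R" for z
  proof (rule has_sum_componentwise)
    fix b :: 'b assume b: "b \<in> Basis"
    then have "R \<le> r b" by (simp add: R_def)
    then have "z \<in> ball p (r b)" using that by auto
    from c[OF b this] show "((\<lambda>n. ((z - p) ^ n *\<^sub>R (\<Sum>b\<in>Basis. c b n *\<^sub>R b)) \<bullet> b) has_sum f z \<bullet> b) UNIV"
      using b by simp
  qed
  show "\<exists>r>0. \<exists>c. \<forall>z\<in>ball p r. ((\<lambda>n. (z - p) ^ n *\<^sub>R c n) has_sum f z) UNIV"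
    using \<open>R > 0\<close>
    by (intro exI[of _ R] conjI exI[of _ "\<lambda>n. \<Sum>b\<in>Basis. c b n *\<^sub>R b"] ballI sum)
qed

subsection \<open>The function $X_0$ and its first integral\<close>

text \<open>$X_0(x) = A(x^2)$, $X_0'(x)/x = 2 A_1(x^2)$ and $C_2(x) = 4x^2 A_2(x^2)$.\<close>

definition A :: "real \<Rightarrow> real" where
  "A t = (\<Sum>n. X0_coeff n * t ^ n)"

definition A1 :: "real \<Rightarrow> real" where
  "A1 t = (\<Sum>n. diffs X0_coeff n * t ^ n)"

definition A2 :: "real \<Rightarrow> real" where
  "A2 t = (\<Sum>n. diffs (diffs X0_coeff) n * t ^ n)"

text \<open>The recurrence gives a ratio of successive coefficients of absolute value at most
  1/(k+1), because 2k-1 is at most 2(4k^2+5/4). Factorial decay makes the series of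
  \<open>X0\<close> and its derivatives converge everywhere.\<close>

lemma X0_coeff_bound: "\<bar>X0_coeff k\<bar> \<le> 5 / 2 / fact k"
proof (induction k)
  case (Suc k)
  show ?case
  proof (cases k)
    case (Suc j)
    have rec: "2 * (real k + 1) * (4 * (real k)\<^sup>2 + 5 / 4) * X0_coeff (k + 1) = - ((2 * real k - 1) * X0_coeff k)"
      using X0_coeff_recurrence[of k] Suc by simp
    have "\<bar>2 * (real k + 1) * (4 * (real k)\<^sup>2 + 5 / 4) * X0_coeff (k + 1)\<bar> = (2 * real k - 1) * \<bar>X0_coeff k\<bar>"
      unfolding rec using Suc by (simp add: abs_mult)
    then have "(2 * (real k + 1) * (4 * (real k)\<^sup>2 + 5 / 4)) * \<bar>X0_coeff (Suc k)\<bar> = (2 * real k - 1) * \<bar>X0_coeff k\<bar>"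
      by (simp add: abs_mult add_nonneg_nonneg)
    moreover have "(2 * real k - 1) * \<bar>X0_coeff k\<bar> \<le> (2 * (4 * (real k)\<^sup>2 + 5 / 4)) * \<bar>X0_coeff k\<bar>"
    proof (rule mult_right_mono)
      have "0 \<le> (2 * real k - 1)\<^sup>2" by simp
      then show "2 * real k - 1 \<le> 2 * (4 * (real k)\<^sup>2 + 5 / 4)"
        by (simp add: power2_eq_square algebra_simps)
    qed simp
    ultimately have "(2 * (4 * (real k)\<^sup>2 + 5 / 4)) * ((real k + 1) * \<bar>X0_coeff (Suc k)\<bar>)
        \<le> (2 * (4 * (real k)\<^sup>2 + 5 / 4)) * \<bar>X0_coeff k\<bar>"
      by (simp add: algebra_simps)
    moreover have "0 < 2 * (4 * (real k)\<^sup>2 + 5 / 4)"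
      by (simp add: add_nonneg_pos)
    ultimately have "(real k + 1) * \<bar>X0_coeff (Suc k)\<bar> \<le> \<bar>X0_coeff k\<bar>"
      by (rule mult_left_le_imp_le)
    then have "\<bar>X0_coeff (Suc k)\<bar> * (real k + 1) \<le> \<bar>X0_coeff k\<bar>"
      by (simp only: mult.commute)
    also have "\<dots> \<le> 5 / 2 / fact k" by (rule Suc.IH)
    finally have "\<bar>X0_coeff (Suc k)\<bar> \<le> 5 / 2 / fact k / (real k + 1)"
      by (rule mult_imp_le_div_pos[rotated]) simp
    then show ?thesis
      by (simp add: mult_ac add.commute del: X0_coeff.simps)
  qed simp
qed simp

lemma summable_X0_coeff: "summable (\<lambda>n. X0_coeff n * t ^ n)"
proof (rule summable_comparison_test')
  show "summable (\<lambda>n. 5 / 2 * (inverse (fact n) * \<bar>t\<bar> ^ n))"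
    by (intro summable_mult summable_exp)
  show "norm (X0_coeff n * t ^ n) \<le> 5 / 2 * (inverse (fact n) * \<bar>t\<bar> ^ n)" for n
    using mult_right_mono[OF X0_coeff_bound[of n], of "\<bar>t\<bar> ^ n"]
    by (simp add: abs_mult power_abs field_simps)
qed

lemmas summable_diffs_X0_coeff = termdiff_converges_all[OF summable_X0_coeff]
lemmas summable_diffs2_X0_coeff = termdiff_converges_all[OF summable_diffs_X0_coeff]

section \<open>The differential equation in the variable t = x^2\<close>

lemma A_deriv: "(A has_real_derivative A1 t) (at t)"
  unfolding A_def[abs_def] A1_def
  by (rule termdiffs_strong_converges_everywhere) (rule summable_X0_coeff)

lemma A1_deriv: "(A1 has_real_derivative A2 t) (at t)"
  unfolding A1_def[abs_def] A2_def
  by (rule termdiffs_strong_converges_everywhere) (rule summable_diffs_X0_coeff)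

text \<open>The operator t d/dt multiplies the n-th coefficient by n.\<close>

lemma sums_times_diffs:
  fixes c :: "nat \<Rightarrow> real"
  assumes "\<And>x. summable (\<lambda>n. c n * x ^ n)"
  shows "(\<lambda>n. (of_nat n * c n) * t ^ n) sums (t * (\<Sum>n. diffs c n * t ^ n))"
proof -
  have "(\<lambda>n. t * (of_nat n * c n * t ^ (n - Suc 0))) sums (t * (\<Sum>n. diffs c n * t ^ n))"
    by (intro sums_mult diffs_equiv termdiff_converges_all assms)
  moreover have "t * (of_nat n * c n * t ^ (n - Suc 0)) = (of_nat n * c n) * t ^ n" for n
    by (cases n) auto
  ultimately show ?thesis by simp
qed

lemma tA2_sums: "(\<lambda>n. (of_nat n * diffs X0_coeff n) * t ^ n) sums (t * A2 t)"
  unfolding A2_def by (rule sums_times_diffs) (rule summable_diffs_X0_coeff)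

text \<open>This is the differential equation for \<open>A1\<close> read off coefficientwise. For
  positive \<open>n\<close> it is the recurrence; for \<open>n = 0\<close>, where the recurrence
  says nothing, it ties the constant term 5/2 to the coefficient 1 that follows it.\<close>

lemma X0_coeff_ode:
  "8 * (real n * (real n * diffs X0_coeff n)) + 5 / 2 * diffs X0_coeff n + 2 * (real n * X0_coeff n)
     = X0_coeff n"
proof (cases "n = 0")
  case False
  then show ?thesis
    using X0_coeff_recurrence[of n]
    by (simp add: diffs_def algebra_simps power2_eq_square del: X0_coeff.simps)
qed (simp add: diffs_def)

text \<open>With \<theta> = t d/dt, \<open>t * A2 t\<close> is \<theta> applied to
  \<open>A1\<close>, and \<open>t * Q\<close> is \<theta> applied twice; the equation is
  \<open>X0_coeff_ode\<close> summed over \<open>n\<close>.\<close>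

lemma tA2_deriv:
  obtains Q where "((\<lambda>t. t * A2 t) has_real_derivative Q) (at t)"
    "8 * (t * Q) + (5 / 2 + 2 * t) * A1 t = A t"
proof -
  define P where "P n = of_nat n * diffs X0_coeff n" for n
  have sP: "summable (\<lambda>n. P n * t ^ n)" for t
    using tA2_sums[of t] by (auto simp: P_def sums_iff)
  define Q where "Q = (\<Sum>n. diffs P n * t ^ n)"
  have "(\<lambda>t. t * A2 t) = (\<lambda>t. \<Sum>n. P n * t ^ n)"
    using tA2_sums by (auto simp: P_def sums_iff fun_eq_iff)
  then have "((\<lambda>t. t * A2 t) has_real_derivative Q) (at t)"
    unfolding Q_def by (simp add: termdiffs_strong_converges_everywhere sP)
  moreover have "8 * (t * Q) + (5 / 2 + 2 * t) * A1 t = A t"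
  proof -
    have "(\<lambda>n. 8 * ((of_nat n * P n) * t ^ n) + 5 / 2 * (diffs X0_coeff n * t ^ n)
              + 2 * ((of_nat n * X0_coeff n) * t ^ n)) sums (8 * (t * Q) + 5 / 2 * A1 t + 2 * (t * A1 t))"
      unfolding Q_def A1_def
      by (intro sums_add sums_mult sums_times_diffs sP summable_sums summable_X0_coeff summable_diffs_X0_coeff)
    moreover have "8 * ((of_nat n * P n) * t ^ n) + 5 / 2 * (diffs X0_coeff n * t ^ n)
              + 2 * ((of_nat n * X0_coeff n) * t ^ n) = X0_coeff n * t ^ n" for n
    proof -
      have "8 * ((of_nat n * P n) * t ^ n) + 5 / 2 * (diffs X0_coeff n * t ^ n)
              + 2 * ((of_nat n * X0_coeff n) * t ^ n) = (8 * (real n * (real n * diffs X0_coeff n))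
              + 5 / 2 * diffs X0_coeff n + 2 * (real n * X0_coeff n)) * t ^ n"
        unfolding P_def by (simp add: algebra_simps)
      then show ?thesis unfolding X0_coeff_ode .
    qed
    ultimately have "(\<lambda>n. X0_coeff n * t ^ n) sums (8 * (t * Q) + 5 / 2 * A1 t + 2 * (t * A1 t))"
      by simp
    moreover have "(\<lambda>n. X0_coeff n * t ^ n) sums A t"
      unfolding A_def by (rule summable_sums) (rule summable_X0_coeff)
    ultimately have "8 * (t * Q) + 5 / 2 * A1 t + 2 * (t * A1 t) = A t"
      by (rule sums_unique2)
    then show ?thesis by (simp add: algebra_simps)
  qed
  ultimately show thesis using that by blast
qed

text \<open>The third-order equation for $A_1$ is the symmetric square of a Bessel equation; this is
  the quadratic first integral coming from the Wronskian.\<close>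

lemma A_first_integral: "4 * A1 t * A t - (5 + 4 * t) * (A1 t)\<^sup>2 - 16 * (t * A2 t)\<^sup>2 = 5"
proof -
  define E where "E t = 4 * A1 t * A t - (5 + 4 * t) * (A1 t)\<^sup>2 - 16 * (t * A2 t)\<^sup>2" for t
  have "(E has_real_derivative 0) (at t)" for t
  proof -
    obtain Q where Q: "((\<lambda>t. t * A2 t) has_real_derivative Q) (at t)"
      and ode: "8 * (t * Q) + (5 / 2 + 2 * t) * A1 t = A t"
      by (rule tA2_deriv)
    have Q2: "((\<lambda>t. 16 * (t * A2 t)\<^sup>2) has_real_derivative 16 * (2 * (t * A2 t) * Q)) (at t)"
      using DERIV_cmult[OF DERIV_power[OF Q, of 2], of 16] by (simp add: mult_ac)
    have "(E has_real_derivative (4 * A2 t * A t + 4 * A1 t * A1 t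
        - (4 * (A1 t)\<^sup>2 + (5 + 4 * t) * (2 * A1 t * A2 t)) - 16 * (2 * (t * A2 t) * Q))) (at t)"
      unfolding E_def[abs_def]
      by (rule DERIV_diff[OF _ Q2])
         (rule derivative_eq_intros A_deriv A1_deriv refl | simp add: algebra_simps)+
    moreover have "4 * A2 t * A t + 4 * A1 t * A1 t
        - (4 * (A1 t)\<^sup>2 + (5 + 4 * t) * (2 * A1 t * A2 t)) - 16 * (2 * (t * A2 t) * Q) = 0"
      \<comment> \<open>Replacing \<open>A t\<close> by the left-hand side of the equation cancels
        both the terms with \<open>Q\<close> and those with \<open>A1 t * A2 t\<close>.\<close>
      unfolding ode[symmetric] by (simp add: algebra_simps power2_eq_square)
    ultimately show ?thesis by simp
  qed
  then have "E t = E 0"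
    using DERIV_isconst_all[of E t 0] by simp
  \<comment> \<open>Here \<open>A 0 = 5 / 2\<close> and \<open>A1 0 = 1\<close>, and the last square
    vanishes.\<close>
  also have "E 0 = 5"
    by (simp add: E_def A_def A1_def diffs_def)
  finally show ?thesis by (simp add: E_def)
qed

text \<open>At a zero of \<open>A1\<close> the first integral would equate a nonpositive number with
  5. Hence \<open>A1\<close> keeps the sign of \<open>A1 0 = 1\<close> by continuity.\<close>

lemma A1_pos: "A1 t > 0"
proof (rule ccontr)
  assume neg: "\<not> A1 t > 0"
  have nz: "A1 s \<noteq> 0" for s
  proof
    assume "A1 s = 0"
    then have "16 * (s * A2 s)\<^sup>2 = - 5" using A_first_integral[of s] by simp
    moreover have "(s * A2 s)\<^sup>2 \<ge> 0" by (rule zero_le_power2)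
    ultimately show False by linarith
  qed
  have cont: "continuous_on T A1" for T
    using A1_deriv by (meson DERIV_isCont continuous_at_imp_continuous_on)
  have A10: "A1 0 = 1" by (simp add: A1_def diffs_def)
  have "\<exists>s. A1 s = 0"
  proof (cases "t \<le> 0")
    case True
    then show ?thesis using IVT'[of A1 t 0 0] neg A10 cont by auto
  next
    case False
    then show ?thesis using IVT2'[of A1 t 0 0] neg A10 cont by auto
  qed
  then show False using nz by blast
qed

section \<open>Return to the variable x: \<open>X0\<close>, \<open>B2\<close> and
  \<open>C2\<close>\<close>

lemma X0_eq: "X0 x = A (x\<^sup>2)"
  by (simp add: X0_def A_def power_mult)

lemma has_real_derivative_square: "((\<lambda>x::real. x\<^sup>2) has_real_derivative 2 * x) (at x)"
  by (auto intro!: derivative_eq_intros)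

lemma deriv_X0: "X0' x = 2 * x * A1 (x\<^sup>2)"
proof (rule DERIV_imp_deriv)
  have "((\<lambda>x. A (x\<^sup>2)) has_real_derivative 2 * x * A1 (x\<^sup>2)) (at x)"
    using DERIV_chain2[OF A_deriv has_real_derivative_square] by (simp add: mult.commute)
  then show "(X0 has_real_derivative 2 * x * A1 (x\<^sup>2)) (at x)"
    by (simp add: X0_eq[abs_def])
qed

lemma deriv2_X0: "X0'' x = 2 * A1 (x\<^sup>2) + 4 * x\<^sup>2 * A2 (x\<^sup>2)"
proof (rule DERIV_imp_deriv)
  have "((\<lambda>x. 2 * x * A1 (x\<^sup>2)) has_real_derivative 2 * A1 (x\<^sup>2) + 4 * x\<^sup>2 * A2 (x\<^sup>2)) (at x)"
    by (rule derivative_eq_intros DERIV_chain2[OF A1_deriv has_real_derivative_square] refl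
        | simp add: power2_eq_square)+
  then show "(X0' has_real_derivative 2 * A1 (x\<^sup>2) + 4 * x\<^sup>2 * A2 (x\<^sup>2)) (at x)"
    by (simp add: deriv_X0[abs_def])
qed

lemma B2_eq: "x > 0 \<Longrightarrow> B2 x = - A1 (x\<^sup>2) - sqrt 5"
  by (simp add: B2_def deriv_X0)

lemma C2_eq: "x > 0 \<Longrightarrow> C2 x = 4 * (x\<^sup>2 * A2 (x\<^sup>2))"
  by (simp add: C2_def deriv_X0 deriv2_X0)

text \<open>The term \<open>B2\<close> alone suffices, being the sum of two negative numbers. This
  makes the normalisation of the second unit vector and the radius 1/sqrt(B2^2+C2^2)
  meaningful.\<close>

lemma B2_C2_pos:
  assumes "x > 0"
  shows "(B2 x)\<^sup>2 + (C2 x)\<^sup>2 > 0"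
proof -
  have "sqrt 5 > 0" by simp
  then have "B2 x < 0"
    using A1_pos[of "x\<^sup>2"] unfolding B2_eq[OF assms] by linarith
  then show ?thesis by (simp add: sum_power2_gt_zero_iff)
qed

lemma locally_holomorphic_A1: "locally_holomorphic A1 t"
  by (rule locally_holomorphic_power_series[where q = 0 and r = "\<bar>t\<bar> + 1"])
     (auto simp: A1_def intro: summable_sums summable_diffs_X0_coeff)

lemma locally_holomorphic_A2: "locally_holomorphic A2 t"
  by (rule locally_holomorphic_power_series[where q = 0 and r = "\<bar>t\<bar> + 1"])
     (auto simp: A2_def intro: summable_sums summable_diffs2_X0_coeff)

lemma locally_holomorphic_compose_square:
  assumes "locally_holomorphic h (p\<^sup>2)"
  shows "locally_holomorphic (\<lambda>x. h (x\<^sup>2)) p"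
  using assms
  by (rule locally_holomorphic_compose)
     (simp_all add: locally_holomorphic_power locally_holomorphic_ident)

lemma locally_holomorphic_B2:
  assumes "p > 0"
  shows "locally_holomorphic B2 p"
proof (rule locally_holomorphic_cong)
  show "locally_holomorphic (\<lambda>x. (-1) * A1 (x\<^sup>2) - sqrt 5) p"
    by (intro locally_holomorphic_diff locally_holomorphic_mult locally_holomorphic_const
          locally_holomorphic_compose_square locally_holomorphic_A1)
  \<comment> \<open>The closed form of \<open>B2\<close> comes from cancelling x in X0'/x, so the
    comparison is made on the positive half-line, a neighbourhood of \<open>p\<close>.\<close>
  show "\<forall>\<^sub>F x in nhds p. (-1) * A1 (x\<^sup>2) - sqrt 5 = B2 x"
    by (rule eventually_mono[OF eventually_nhds_in_open[of "{0<..}"]])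
       (use assms in \<open>auto simp: B2_eq\<close>)
qed

lemma locally_holomorphic_C2:
  assumes "p > 0"
  shows "locally_holomorphic C2 p"
proof (rule locally_holomorphic_cong)
  show "locally_holomorphic (\<lambda>x. 4 * (x\<^sup>2 * A2 (x\<^sup>2))) p"
    by (intro locally_holomorphic_mult locally_holomorphic_const
          locally_holomorphic_compose_square locally_holomorphic_A2
          locally_holomorphic_power locally_holomorphic_ident)
  show "\<forall>\<^sub>F x in nhds p. 4 * (x\<^sup>2 * A2 (x\<^sup>2)) = C2 x"
    by (rule eventually_mono[OF eventually_nhds_in_open[of "{0<..}"]])
       (use assms in \<open>auto simp: C2_eq\<close>)
qed

subsection \<open>The frame and the spherical curves\<close>

lemma constant_of_derivative_zero:
  fixes g :: "real \<Rightarrow> 'a::real_normed_vector"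
  assumes "convex S" "\<And>x. x \<in> S \<Longrightarrow> (g has_vector_derivative 0) (at x)" "x \<in> S" "y \<in> S"
  shows "g x = g y"
proof -
  obtain c where "\<And>x. x \<in> S \<Longrightarrow> g x = c"
    using has_vector_derivative_zero_constant[of S g] assms(1,2) has_vector_derivative_at_within
    by blast
  then show ?thesis using assms(3,4) by simp
qed

text \<open>\<open>v x\<close> is the vector from the point of the curve to the candidate centre
  \<open>c\<close>. Its length gives the radius, and its orthogonality to \<open>n\<close> keeps the
  curve in the hyperplane through \<open>c\<close>.\<close>

lemma curve_on_sphere2_in_hyperplane:
  assumes "r > 0" "norm n = 1"
    and "\<And>x. x \<in> T \<Longrightarrow> g x + v x = c"
    and "\<And>x. x \<in> T \<Longrightarrow> norm (v x) = r"
    and "\<And>x. x \<in> T \<Longrightarrow> n \<bullet> v x = 0"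
  shows "\<exists>S. is_sphere2_in_hyperplane S r n \<and> (\<forall>x\<in>T. g x \<in> S)"
proof (intro exI conjI ballI)
  show "is_sphere2_in_hyperplane (sphere c r \<inter> {p. n \<bullet> p = n \<bullet> c}) r n"
    using assms(1,2) unfolding is_sphere2_in_hyperplane_def by auto
  fix x assume x: "x \<in> T"
  have c: "c = g x + v x" using assms(3)[OF x] by simp
  show "g x \<in> sphere c r \<inter> {p. n \<bullet> p = n \<bullet> c}"
    using assms(4,5)[OF x] by (simp add: c dist_norm inner_add_right)
qed

lemma norm_eq_of_power2:
  assumes "v \<bullet> v = r\<^sup>2" "r \<ge> 0"
  shows "norm v = r"
  using assms by (simp add: norm_eq_sqrt_inner)

locale framed_curvature_surface =
  fixes f \<phi> X\<alpha> X\<beta> \<xi> :: "real \<times> real \<Rightarrow> real^4"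
  assumes surface: "curvature_surface f \<phi> X\<alpha> X\<beta> \<xi>"
begin

section \<open>Frame and surface equations along coordinate lines\<close>

lemma frame: "frame_field \<phi> X\<alpha> X\<beta> \<xi>"
  using surface by (simp add: curvature_surface_def)

lemma analytic: "\<phi> real_analytic_on D" "X\<alpha> real_analytic_on D" "X\<beta> real_analytic_on D" "\<xi> real_analytic_on D"
  using frame by (simp_all add: frame_field_def)

lemma orthonormal: "x > 0 \<Longrightarrow> orthonormal4 (\<phi> (x, y)) (X\<alpha> (x, y)) (X\<beta> (x, y)) (\<xi> (x, y))"
  using frame by (simp add: frame_field_def D_def)

lemma frame_inner:
  assumes "x > 0"
  shows "\<phi> (x, y) \<bullet> \<phi> (x, y) = 1" "X\<alpha> (x, y) \<bullet> X\<alpha> (x, y) = 1" "X\<beta> (x, y) \<bullet> X\<beta> (x, y) = 1"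
    "\<xi> (x, y) \<bullet> \<xi> (x, y) = 1"
    "\<phi> (x, y) \<bullet> X\<alpha> (x, y) = 0" "\<phi> (x, y) \<bullet> X\<beta> (x, y) = 0" "\<phi> (x, y) \<bullet> \<xi> (x, y) = 0"
    "X\<alpha> (x, y) \<bullet> X\<beta> (x, y) = 0" "X\<alpha> (x, y) \<bullet> \<xi> (x, y) = 0" "X\<beta> (x, y) \<bullet> \<xi> (x, y) = 0"
    "X\<alpha> (x, y) \<bullet> \<phi> (x, y) = 0" "X\<beta> (x, y) \<bullet> \<phi> (x, y) = 0" "\<xi> (x, y) \<bullet> \<phi> (x, y) = 0"
    "X\<beta> (x, y) \<bullet> X\<alpha> (x, y) = 0" "\<xi> (x, y) \<bullet> X\<alpha> (x, y) = 0" "\<xi> (x, y) \<bullet> X\<beta> (x, y) = 0"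
  using orthonormal[OF assms, of y] by (simp_all add: orthonormal4_def norm_eq_1 inner_commute)

lemma frame_dx:
  assumes "x > 0"
  shows "((\<lambda>t. \<phi> (t, y)) has_vector_derivative - a1 x y *\<^sub>R X\<alpha> (x, y)) (at x)"
    "((\<lambda>t. \<xi> (t, y)) has_vector_derivative b1 x y *\<^sub>R X\<alpha> (x, y)) (at x)"
    "((\<lambda>t. X\<beta> (t, y)) has_vector_derivative c1 x y *\<^sub>R X\<alpha> (x, y)) (at x)"
  using frame assms by (simp_all add: frame_field_def D_def)

text \<open>\<open>b2\<close> and \<open>c2\<close> both contain the factor 2y/h, which is also the
  coefficient of \<open>X\<beta>\<close> in the differential of \<open>f\<close>. Removing it leaves
  functions of \<open>x\<close> alone, the source of all constancy along y-curves.\<close>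

lemma b2_eq: "b2 x y = 2 * y / hh x y * B2 x"
  by (simp add: b2_def B2_def algebra_simps add_divide_distrib)

lemma c2_eq: "c2 x y = 2 * y / hh x y * C2 x"
  by (simp add: c2_def C2_def)

lemma frame_dy:
  assumes "x > 0"
  shows "((\<lambda>t. \<xi> (x, t)) has_vector_derivative b2 x y *\<^sub>R X\<beta> (x, y)) (at y)"
    "((\<lambda>t. X\<alpha> (x, t)) has_vector_derivative c2 x y *\<^sub>R X\<beta> (x, y)) (at y)"
  using frame assms by (simp_all add: frame_field_def D_def)

lemma surface_dx:
  assumes "x > 0"
  shows "((\<lambda>t. f (t, y)) has_vector_derivative ((x\<^sup>2 - y\<^sup>2) / (x * hh x y)) *\<^sub>R X\<alpha> (x, y)) (at x)"
proof -
  have "(f has_derivative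
           (\<lambda>(dx, dy). dx *\<^sub>R ((x\<^sup>2 - y\<^sup>2) / (x * hh x y)) *\<^sub>R X\<alpha> (x, y)
                     + dy *\<^sub>R (2 * y / hh x y) *\<^sub>R X\<beta> (x, y))) (at (x, y))"
    using surface assms by (simp add: curvature_surface_def D_def)
  from has_derivative_compose[OF has_derivative_Pair[OF has_derivative_ident has_derivative_const] this]
  show ?thesis by (simp add: has_vector_derivative_def)
qed

lemma surface_dy:
  assumes "x > 0"
  shows "((\<lambda>t. f (x, t)) has_vector_derivative (2 * y / hh x y) *\<^sub>R X\<beta> (x, y)) (at y)"
proof -
  have "(f has_derivative
           (\<lambda>(dx, dy). dx *\<^sub>R ((x\<^sup>2 - y\<^sup>2) / (x * hh x y)) *\<^sub>R X\<alpha> (x, y)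
                     + dy *\<^sub>R (2 * y / hh x y) *\<^sub>R X\<beta> (x, y))) (at (x, y))"
    using surface assms by (simp add: curvature_surface_def D_def)
  from has_derivative_compose[OF has_derivative_Pair[OF has_derivative_const has_derivative_ident] this]
  show ?thesis by (simp add: has_vector_derivative_def)
qed

section \<open>The unit normals of the two families of hyperplanes\<close>

definition U :: "real \<Rightarrow> real \<Rightarrow> real^4" where
  "U x y = (1 / sqrt (1 + y\<^sup>2)) *\<^sub>R (y *\<^sub>R X\<beta> (x, y) - \<phi> (x, y))"

definition V :: "real \<Rightarrow> real \<Rightarrow> real^4" where
  "V x y = (1 / sqrt ((B2 x)\<^sup>2 + (C2 x)\<^sup>2)) *\<^sub>R (- B2 x *\<^sub>R X\<alpha> (x, y) + C2 x *\<^sub>R \<xi> (x, y))"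

text \<open>Along x-curves both terms move parallel to \<open>X\<alpha>\<close>, and the relation
  \<open>a1 x y = - y * c1 x y\<close> cancels the motions. The point 1 is a fixed reference on the
  half-line.\<close>

lemma U_indep_x:
  assumes "x > 0"
  shows "U x y = U 1 y"
proof (rule constant_of_derivative_zero[where S = "{0<..}" and g = "\<lambda>x. U x y"])
  fix x :: real assume "x \<in> {0<..}"
  then have "((\<lambda>t. U t y) has_vector_derivative
      (1 / sqrt (1 + y\<^sup>2)) *\<^sub>R (y *\<^sub>R (c1 x y *\<^sub>R X\<alpha> (x, y)) - (- a1 x y *\<^sub>R X\<alpha> (x, y)))) (at x)"
    unfolding U_def by (auto intro!: derivative_eq_intros frame_dx)
  moreover have "a1 x y = - y * c1 x y"
    by (simp add: a1_def c1_def)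
  ultimately show "((\<lambda>t. U t y) has_vector_derivative 0) (at x)"
    by simp
qed (use assms in auto)

text \<open>Both derivatives are multiples of \<open>X\<beta>\<close>; they cancel because
  \<open>b2\<close> and \<open>c2\<close> are proportional to \<open>B2\<close> and
  \<open>C2\<close>.\<close>

lemma V_indep_y:
  assumes "x > 0"
  shows "V x y = V x 0"
proof (rule constant_of_derivative_zero[where S = UNIV])
  fix y :: real
  have "((\<lambda>t. V x t) has_vector_derivative (1 / sqrt ((B2 x)\<^sup>2 + (C2 x)\<^sup>2)) *\<^sub>R
      (- B2 x *\<^sub>R (c2 x y *\<^sub>R X\<beta> (x, y)) + C2 x *\<^sub>R (b2 x y *\<^sub>R X\<beta> (x, y)))) (at y)"
    unfolding V_def using assms by (auto intro!: derivative_eq_intros frame_dy)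
  moreover have "B2 x * c2 x y = C2 x * b2 x y"
    by (simp add: b2_eq c2_eq)
  ultimately show "((\<lambda>t. V x t) has_vector_derivative 0) (at y)"
    by simp
qed auto

lemma norm_U:
  assumes "x > 0"
  shows "norm (U x y) = 1"
proof (rule norm_eq_of_power2)
  have "1 + y\<^sup>2 > 0" by (simp add: add_pos_nonneg)
  then show "U x y \<bullet> U x y = 1\<^sup>2"
    by (simp add: U_def inner_diff frame_inner assms) (simp add: field_simps power2_eq_square)
qed simp

lemma norm_V:
  assumes "x > 0"
  shows "norm (V x y) = 1"
proof (rule norm_eq_of_power2)
  have "V x y \<bullet> V x y = (1 / sqrt ((B2 x)\<^sup>2 + (C2 x)\<^sup>2))\<^sup>2 * ((B2 x)\<^sup>2 + (C2 x)\<^sup>2)"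
    unfolding V_def inner_scaleR_left inner_scaleR_right
    by (simp only: power2_eq_square mult.assoc)
       (simp add: inner_add inner_diff frame_inner assms)
  then show "V x y \<bullet> V x y = 1\<^sup>2"
    using B2_C2_pos[OF assms] by (auto simp: power_divide)
qed simp

text \<open>Fixing x = 1 expresses the vector through the frame on a single coordinate line, where
  each component has a local holomorphic extension.\<close>

lemma U_analytic: "U 1 real_analytic_on UNIV"
proof (rule real_analytic_onI_components)
  fix p :: real and b :: "real^4"
  have F: "locally_holomorphic (\<lambda>t. F (1, t) \<bullet> b) p" if "F real_analytic_on D" for F :: "real \<times> real \<Rightarrow> real^4"
    using real_analytic_on_imp_locally_holomorphic[OF that, of "(1, 0)" p "(0, 1)" b]
    by (simp add: D_def Basis_prod_def)
  have "locally_holomorphic (\<lambda>t. 1 / sqrt (1 + t\<^sup>2) * (t * (X\<beta> (1, t) \<bullet> b) - \<phi> (1, t) \<bullet> b)) p"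
    by (intro locally_holomorphic_mult locally_holomorphic_diff locally_holomorphic_inverse_sqrt
          locally_holomorphic_add locally_holomorphic_power locally_holomorphic_const
          locally_holomorphic_ident F analytic) (simp_all add: add_pos_nonneg)
  then show "locally_holomorphic (\<lambda>t. U 1 t \<bullet> b) p"
    by (simp add: U_def inner_diff_left)
qed

lemma V_analytic: "(\<lambda>x. V x 0) real_analytic_on {0<..}"
proof (rule real_analytic_onI_components)
  fix p :: real and b :: "real^4" assume p: "p \<in> {0<..}"
  have F: "locally_holomorphic (\<lambda>t. F (t, 0) \<bullet> b) p" if "F real_analytic_on D" for F :: "real \<times> real \<Rightarrow> real^4"
    using real_analytic_on_imp_locally_holomorphic[OF that, of "(0, 0)" p "(1, 0)" b] p
    by (simp add: D_def Basis_prod_def)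
  have B: "locally_holomorphic B2 p" and C: "locally_holomorphic C2 p"
    using p by (simp_all add: locally_holomorphic_B2 locally_holomorphic_C2)
  have "locally_holomorphic (\<lambda>t. 1 / sqrt ((B2 t)\<^sup>2 + (C2 t)\<^sup>2) *
      (C2 t * (\<xi> (t, 0) \<bullet> b) - B2 t * (X\<alpha> (t, 0) \<bullet> b))) p"
    using p B2_C2_pos[of p]
    by (intro locally_holomorphic_mult locally_holomorphic_diff locally_holomorphic_inverse_sqrt
          locally_holomorphic_add locally_holomorphic_power B C F analytic) auto
  then show "locally_holomorphic (\<lambda>t. V t 0 \<bullet> b) p"
    by (simp add: V_def inner_add_left inner_diff_left)
qed

text \<open>The coefficients of the vector from the curve to the centre are forced by constancy of the
  centre and orthogonality to $U$ (respectively $V$).\<close>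

lemma x_curve_on_sphere:
  "\<exists>S. is_sphere2_in_hyperplane S (1 / (2 * sqrt 5) * sqrt ((5 + 4 * y\<^sup>2) / (1 + y\<^sup>2))) (U 1 y) \<and>
     (\<forall>x\<in>{0<..}. f (x, y) \<in> S)"
proof -
  \<comment> \<open>Orthogonality to \<open>U\<close> makes the coefficient of \<open>\<phi>\<close>
    equal to y times that of \<open>X\<beta>\<close>. In the derivative, cancelling x^2-y^2 forces
    the coefficient 1/sqrt 5 of \<open>\<xi>\<close>, and cancelling X0 + sqrt 5/2 then forces
    \<open>m\<close>.\<close>
  define m where "m = - 1 / (2 * sqrt 5 * (1 + y\<^sup>2))"
  define v where "v x = (1 / sqrt 5) *\<^sub>R \<xi> (x, y) + m *\<^sub>R X\<beta> (x, y) + (y * m) *\<^sub>R \<phi> (x, y)" for x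
  have y_pos: "1 + y\<^sup>2 > 0" "5 + 4 * y\<^sup>2 > 0" by (simp_all add: add_pos_nonneg)
  have m: "m * (1 + y\<^sup>2) = - 1 / (2 * sqrt 5)"
    using y_pos by (simp add: m_def)
  have deriv: "((\<lambda>t. f (t, y) + v t) has_vector_derivative 0) (at x)" if x: "x > 0" for x
  proof -
    have "((\<lambda>t. f (t, y) + v t) has_vector_derivative
        (((x\<^sup>2 - y\<^sup>2) / (x * hh x y)) *\<^sub>R X\<alpha> (x, y) + ((1 / sqrt 5) *\<^sub>R (b1 x y *\<^sub>R X\<alpha> (x, y))
          + m *\<^sub>R (c1 x y *\<^sub>R X\<alpha> (x, y)) + (y * m) *\<^sub>R (- a1 x y *\<^sub>R X\<alpha> (x, y))))) (at x)"
      unfolding v_def using x by (auto intro!: derivative_eq_intros frame_dx surface_dx)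
    also have "((x\<^sup>2 - y\<^sup>2) / (x * hh x y)) *\<^sub>R X\<alpha> (x, y) + ((1 / sqrt 5) *\<^sub>R (b1 x y *\<^sub>R X\<alpha> (x, y))
          + m *\<^sub>R (c1 x y *\<^sub>R X\<alpha> (x, y)) + (y * m) *\<^sub>R (- a1 x y *\<^sub>R X\<alpha> (x, y)))
        = ((x\<^sup>2 - y\<^sup>2) / (x * hh x y) + b1 x y / sqrt 5 + m * c1 x y - y * m * a1 x y) *\<^sub>R X\<alpha> (x, y)"
      by (simp add: algebra_simps)
    also have "(x\<^sup>2 - y\<^sup>2) / (x * hh x y) + b1 x y / sqrt 5 + m * c1 x y - y * m * a1 x y
        = (1 / (x * hh x y)) * (x\<^sup>2 - y\<^sup>2 - (X0 x + sqrt 5 / 2 + sqrt 5 * (x\<^sup>2 - y\<^sup>2)) / sqrt 5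
            - 2 * (X0 x + sqrt 5 / 2) * (m * (1 + y\<^sup>2)))"
    proof -
      \<comment> \<open>In terms of \<open>K\<close> and \<open>P\<close> the frame coefficients are
        polynomial, and the two occurrences of \<open>m\<close> combine into
        \<open>m * (1 + y\<^sup>2)\<close>.\<close>
      define K where "K = 1 / (x * hh x y)"
      define P where "P = X0 x + sqrt 5 / 2"
      have "(x\<^sup>2 - y\<^sup>2) / (x * hh x y) = (x\<^sup>2 - y\<^sup>2) * K" "a1 x y = 2 * y * K * P"
        "b1 x y = - K * (P + sqrt 5 * (x\<^sup>2 - y\<^sup>2))" "c1 x y = - (2 * K) * P"
        by (simp_all add: a1_def b1_def c1_def K_def P_def)
      then show ?thesis
        unfolding K_def[symmetric] P_def[symmetric]
        by (simp only:) (simp add: algebra_simps power2_eq_square add_divide_distrib diff_divide_distrib)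
    qed
    also have "\<dots> = 0"
      unfolding m by (simp add: field_simps)
    finally show ?thesis by simp
  qed
  show ?thesis
  proof (rule curve_on_sphere2_in_hyperplane[where v = v and c = "f (1, y) + v 1"])
    show "1 / (2 * sqrt 5) * sqrt ((5 + 4 * y\<^sup>2) / (1 + y\<^sup>2)) > 0"
      using y_pos by simp
    show "norm (U 1 y) = 1" by (rule norm_U) simp
    fix x :: real assume "x \<in> {0<..}"
    then have x: "x > 0" by simp
    show "f (x, y) + v x = f (1, y) + v 1"
      by (rule constant_of_derivative_zero[where S = "{0<..}" and g = "\<lambda>x. f (x, y) + v x"])
         (use x deriv in auto)
    have "U x y \<bullet> v x = 0"
      by (simp add: U_def v_def inner_add inner_diff frame_inner[OF x])
    then show "U 1 y \<bullet> v x = 0" by (simp only: U_indep_x[OF x, of y])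
    show "norm (v x) = 1 / (2 * sqrt 5) * sqrt ((5 + 4 * y\<^sup>2) / (1 + y\<^sup>2))"
    proof (rule norm_eq_of_power2)
      \<comment> \<open>The three frame components contribute 1/5, m^2 and y^2 m^2; the sum is
        (5+4y^2)/(20(1+y^2)).\<close>
      have "v x \<bullet> v x = 1 / 5 + m * (m * (1 + y\<^sup>2))"
        by (simp add: v_def inner_add frame_inner[OF x]) (simp add: algebra_simps power2_eq_square)
      also have "\<dots> = 1 / 5 + 1 / (20 * (1 + y\<^sup>2))"
        unfolding m by (simp add: m_def field_simps flip: power2_eq_square)
      also have "\<dots> = (1 / (2 * sqrt 5) * sqrt ((5 + 4 * y\<^sup>2) / (1 + y\<^sup>2)))\<^sup>2"
        using y_pos by (simp add: power_mult_distrib power_divide) (simp add: field_simps)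
      finally show "v x \<bullet> v x = (1 / (2 * sqrt 5) * sqrt ((5 + 4 * y\<^sup>2) / (1 + y\<^sup>2)))\<^sup>2" .
    qed (use y_pos in simp)
  qed
qed

lemma y_curve_on_sphere:
  assumes x: "x > 0"
  shows "\<exists>S. is_sphere2_in_hyperplane S (1 / sqrt ((B2 x)\<^sup>2 + (C2 x)\<^sup>2)) (V x 0) \<and>
     (\<forall>y\<in>UNIV. f (x, y) \<in> S)"
proof -
  define N where "N = (B2 x)\<^sup>2 + (C2 x)\<^sup>2"
  have N: "N > 0" using B2_C2_pos[OF x] by (simp add: N_def)
  \<comment> \<open>Orthogonality to \<open>V\<close> makes this vector proportional to
    \<open>C2 x\<close> times \<open>X\<alpha>\<close> plus \<open>B2 x\<close> times
    \<open>\<xi>\<close>. The factor -1/N makes its derivative cancel the derivative of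
    \<open>f\<close>, and its squared length is then 1/N.\<close>
  define v where "v y = (- C2 x / N) *\<^sub>R X\<alpha> (x, y) + (- B2 x / N) *\<^sub>R \<xi> (x, y)" for y
  have deriv: "((\<lambda>t. f (x, t) + v t) has_vector_derivative 0) (at y)" for y
  proof -
    have "((\<lambda>t. f (x, t) + v t) has_vector_derivative
        ((2 * y / hh x y) *\<^sub>R X\<beta> (x, y) + ((- C2 x / N) *\<^sub>R (c2 x y *\<^sub>R X\<beta> (x, y))
          + (- B2 x / N) *\<^sub>R (b2 x y *\<^sub>R X\<beta> (x, y))))) (at y)"
      unfolding v_def using x by (auto intro!: derivative_eq_intros frame_dy surface_dy)
    also have "(2 * y / hh x y) *\<^sub>R X\<beta> (x, y) + ((- C2 x / N) *\<^sub>R (c2 x y *\<^sub>R X\<beta> (x, y))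
          + (- B2 x / N) *\<^sub>R (b2 x y *\<^sub>R X\<beta> (x, y)))
        = (2 * y / hh x y - C2 x / N * c2 x y - B2 x / N * b2 x y) *\<^sub>R X\<beta> (x, y)"
      by (simp add: algebra_simps)
    also have "2 * y / hh x y - C2 x / N * c2 x y - B2 x / N * b2 x y = 0"
    proof -
      have "2 * y / hh x y - C2 x / N * c2 x y - B2 x / N * b2 x y
          = 2 * y / hh x y * (1 - ((B2 x)\<^sup>2 + (C2 x)\<^sup>2) / N)"
        by (simp add: b2_eq c2_eq power2_eq_square add_divide_distrib algebra_simps)
      also have "(B2 x)\<^sup>2 + (C2 x)\<^sup>2 = N" by (simp add: N_def)
      finally have "2 * y / hh x y - C2 x / N * c2 x y - B2 x / N * b2 x y = 2 * y / hh x y * (1 - N / N)" .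
      then show ?thesis using N by simp
    qed
    finally show ?thesis by simp
  qed
  show ?thesis
    unfolding N_def[symmetric]
  proof (rule curve_on_sphere2_in_hyperplane[where v = v and c = "f (x, 0) + v 0"])
    show "1 / sqrt N > 0" using N by simp
    show "norm (V x 0) = 1" by (rule norm_V) (rule x)
    fix y :: real
    show "f (x, y) + v y = f (x, 0) + v 0"
      by (rule constant_of_derivative_zero[where S = UNIV and g = "\<lambda>y. f (x, y) + v y"])
         (use deriv in auto)
    have "V x y \<bullet> v y = 0"
      by (simp add: V_def v_def inner_add inner_diff frame_inner[OF x])
    then show "V x 0 \<bullet> v y = 0" by (simp only: V_indep_y[OF x, of y])
    show "norm (v y) = 1 / sqrt N"
    proof (rule norm_eq_of_power2)
      have "v y \<bullet> v y = N / N\<^sup>2"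
        by (simp add: v_def inner_add inner_diff frame_inner[OF x])
           (simp add: N_def power2_eq_square add_divide_distrib)
      then show "v y \<bullet> v y = (1 / sqrt N)\<^sup>2"
        using N by (simp add: power_divide power2_eq_square)
    qed (use N in simp)
  qed
qed

end

theorem theorem2:
  fixes f \<phi> X\<alpha> X\<beta> \<xi> :: "real \<times> real \<Rightarrow> real^4"
  assumes "curvature_surface f \<phi> X\<alpha> X\<beta> \<xi>"
  shows "\<exists>u ut :: real \<Rightarrow> real^4.
    (\<forall>x y. (x, y) \<in> D \<longrightarrow>
       (1 / sqrt (1 + y\<^sup>2)) *\<^sub>R (y *\<^sub>R X\<beta> (x, y) - \<phi> (x, y)) = u y) \<and>
    (\<forall>y. norm (u y) = 1) \<and> u real_analytic_on UNIV \<and>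
    (\<forall>y. \<exists>S. is_sphere2_in_hyperplane S
           (1 / (2 * sqrt 5) * sqrt ((5 + 4 * y\<^sup>2) / (1 + y\<^sup>2))) (u y) \<and>
         (\<forall>x>0. f (x, y) \<in> S)) \<and>
    (\<forall>x y. (x, y) \<in> D \<longrightarrow>
       (1 / sqrt ((B2 x)\<^sup>2 + (C2 x)\<^sup>2)) *\<^sub>R (- B2 x *\<^sub>R X\<alpha> (x, y) + C2 x *\<^sub>R \<xi> (x, y)) = ut x) \<and>
    (\<forall>x>0. norm (ut x) = 1) \<and> ut real_analytic_on {0<..} \<and>
    (\<forall>x>0. \<exists>S. is_sphere2_in_hyperplane S (1 / sqrt ((B2 x)\<^sup>2 + (C2 x)\<^sup>2)) (ut x) \<and>
         (\<forall>y. f (x, y) \<in> S))"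
proof -
  interpret framed_curvature_surface f \<phi> X\<alpha> X\<beta> \<xi>
    using assms by unfold_locales
  show ?thesis
    unfolding D_def
  \<comment> \<open>By the two independence lemmas the vectors may be read off at the reference
    values x = 1 and y = 0.\<close>
  proof (rule exI[of _ "U 1"], rule exI[of _ "\<lambda>x. V x 0"], intro conjI allI impI)
    show "(1 / sqrt (1 + y\<^sup>2)) *\<^sub>R (y *\<^sub>R X\<beta> (x, y) - \<phi> (x, y)) = U 1 y"
      if "(x, y) \<in> {(x, y). x > 0}" for x y
      using U_indep_x[of x y] that by (simp add: U_def)
    show "(1 / sqrt ((B2 x)\<^sup>2 + (C2 x)\<^sup>2)) *\<^sub>R (- B2 x *\<^sub>R X\<alpha> (x, y) + C2 x *\<^sub>R \<xi> (x, y)) = V x 0"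
      if "(x, y) \<in> {(x, y). x > 0}" for x y
      using V_indep_y[of x y] that by (simp add: V_def)
    show "\<exists>S. is_sphere2_in_hyperplane S (1 / (2 * sqrt 5) * sqrt ((5 + 4 * y\<^sup>2) / (1 + y\<^sup>2))) (U 1 y) \<and>
        (\<forall>x>0. f (x, y) \<in> S)" for y
      using x_curve_on_sphere[of y] by auto
    show "\<exists>S. is_sphere2_in_hyperplane S (1 / sqrt ((B2 x)\<^sup>2 + (C2 x)\<^sup>2)) (V x 0) \<and>
        (\<forall>y. f (x, y) \<in> S)" if "x > 0" for x
      using y_curve_on_sphere[OF that] by auto
  qed (simp_all add: norm_U norm_V U_analytic V_analytic)
qed

end
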